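(* Let $k \ge 1$, let $0 \le p \le q \le 1$, and let $u \in \mathbb{R}^k$. Let $m$ be the number of (strictly) positive entries of $u$, and suppose the entries of $u$ are ordered so that $u_1,\dots,u_m$ are the positive ones. Let $z^*$ be the minimizer of $$\min_{z \in \mathbb{R}^k,\; z \ge 0,\; p \le 1^T z \le q} \|u - z\|^2 .$$ Then: (1) if $1^T u_{1:m} < p$, then $z^* = \operatorname{argmin}_{z \in \Delta_p} \|u - z\|^2$; (2) if $p \le 1^T u_{1:m} \le q$, then $z^*_{1:m} = u_{1:m}$ and $z^*_{m+1:k} = 0$; (3) if $1^T u_{1:m} > q$, then $z^* = \operatorname{argmin}_{z \in \Delta_q} \|u - z\|^2$.
   Context: $\|\cdot\|$ is the Euclidean norm; $1$ denotes the all-ones vector of appropriate dimension, so $1^T z$ is the sum of the entries of $z$; vector inequalities are componentwise. $u_{a:b}$ denotes the subvector $(u_a,\dots,u_b)$ (empty if $a>b$, with sum $0$). For $s \ge 0$, $\Delta_s = \{z \in \mathbb{R}^k : z \ge 0,\ 1^T z = s\}$ is the scaled simplex. *)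

theory Defs
  imports "HOL-Analysis.Analysis"
begin

(* On real ^ 'k the library order is componentwise and 1 is the all-ones vector,
   so 1 \<bullet> z is the sum of the entries of z. *)

definition sum_band :: "real \<Rightarrow> real \<Rightarrow> (real ^ 'k::finite) set" where
  "sum_band p q = {z. 0 \<le> z \<and> p \<le> 1 \<bullet> z \<and> 1 \<bullet> z \<le> q}"

definition scaled_simplex :: "real \<Rightarrow> (real ^ 'k::finite) set" where
  "scaled_simplex s = {z. 0 \<le> z \<and> 1 \<bullet> z = s}"

(* The set of all minimizers: an equation argmin_set f S = {x} says that a minimizer
   exists, is unique, and is x. *)
definition argmin_set :: "('a \<Rightarrow> real) \<Rightarrow> 'a set \<Rightarrow> 'a set" where
  "argmin_set f S = {x. is_arg_min f (\<lambda>z. z \<in> S) x}"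

(* The remaining lemmas show that all the projections involved have exactly one minimizer. *)

lemma scaled_simplex_eq_sum_band: "scaled_simplex s = sum_band s s"
  by (auto simp: scaled_simplex_def sum_band_def)

lemma closed_convex_sum_band:
  "closed (sum_band p q :: (real ^ 'k::finite) set)"
  "convex (sum_band p q :: (real ^ 'k::finite) set)"
proof -
  have eq: "(sum_band p q :: (real ^ 'k) set) =
      (\<Inter>i. {z. axis i 1 \<bullet> z \<ge> 0}) \<inter> ({z. 1 \<bullet> z \<ge> p} \<inter> {z. 1 \<bullet> z \<le> q})"
    by (auto simp: sum_band_def less_eq_vec_def inner_axis inner_commute)
  show "closed (sum_band p q :: (real ^ 'k) set)"
    unfolding eq by (intro closed_Int closed_INT ballI closed_halfspace_le closed_halfspace_ge)
  show "convex (sum_band p q :: (real ^ 'k) set)"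
    unfolding eq by (intro convex_Int convex_INT convex_halfspace_le convex_halfspace_ge)
qed

lemma sum_band_nonempty:
  assumes "0 \<le> p" "p \<le> q"
  shows "(sum_band p q :: (real ^ 'k::finite) set) \<noteq> {}"
proof -
  have "axis undefined p \<in> (sum_band p q :: (real ^ 'k) set)"
    using assms by (auto simp: sum_band_def less_eq_vec_def inner_axis) (simp add: axis_def)
  then show ?thesis by blast
qed

lemma argmin_set_sum_band:
  fixes u :: "real ^ 'k::finite"
  assumes "0 \<le> p" "p \<le> q"
  shows "\<exists>z. argmin_set (\<lambda>z. (norm (u - z))\<^sup>2) (sum_band p q) = {z}"
proof -
  let ?S = "sum_band p q :: (real ^ 'k) set"
  note S = closed_convex_sum_band[of p q, where 'k = 'k] sum_band_nonempty[OF assms, where 'k = 'k]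
  have iff: "x \<in> argmin_set (\<lambda>z. (norm (u - z))\<^sup>2) ?S \<longleftrightarrow> x \<in> ?S \<and> (\<forall>y\<in>?S. dist u x \<le> dist u y)" for x
    by (auto simp: argmin_set_def is_arg_min_def dist_norm not_less)
  have "argmin_set (\<lambda>z. (norm (u - z))\<^sup>2) ?S = {closest_point ?S u}"
    using closest_point_exists[OF S(1) S(3), of u] closest_point_unique[OF S(2) S(1)] iff by blast
  then show ?thesis by blast
qed

lemma argmin_set_scaled_simplex:
  fixes u :: "real ^ 'k::finite"
  assumes "0 \<le> s"
  shows "\<exists>z. argmin_set (\<lambda>z. (norm (u - z))\<^sup>2) (scaled_simplex s) = {z}"
  using argmin_set_sum_band[of s s u] assms by (simp add: scaled_simplex_eq_sum_band)

end

theory Submission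
  imports Defs
begin

text \<open>
  All three cases come from comparing the band with the whole nonnegative orthant. The projection
  of u onto the orthant is its positive part v, whose entries sum to S, the sum of the positive
  entries of u, and every other nonnegative point is strictly further from u than v is
  (\<open>pos_part_strictly_closest\<close>). If p \<open>\<le>\<close> S \<open>\<le>\<close> q, then v
  itself lies in the band, so it is the minimizer. If S lies below p or above q, then moving from the
  minimizer towards v strictly decreases the distance to u by convexity, while the sum of the entries
  moves linearly towards S. Were that sum not already equal to the bound lying between it and S,
  such a move could be stopped exactly at that bound, still inside the band, which contradicts
  minimality (\<open>sum_argmin_between\<close>). Hence the minimizer lies on a face
  of the band that is a scaled simplex, and there it is the unique minimizer, because the face is
  part of the band.
\<close>

definition pos_part :: "real ^ 'k \<Rightarrow> real ^ 'k::finite" where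
  "pos_part u = (\<chi> i. max (u $ i) 0)"

lemma pos_part_nth [simp]: "pos_part u $ i = max (u $ i) 0"
  by (simp add: pos_part_def)

lemma pos_part_nonneg: "0 \<le> pos_part u"
  by (simp add: less_eq_vec_def)

text \<open>
  The vector from v to u is supported where u is negative, and there v vanishes; hence its
  inner product with z - v is at most 0 for every z in the orthant, and expanding the square of the
  distance from u to z through v leaves at least the square of the distance from v to z as excess.
\<close>
lemma pos_part_strictly_closest:
  fixes u z :: "real ^ 'k::finite"
  assumes "0 \<le> z" "z \<noteq> pos_part u"
  shows "norm (u - pos_part u) < norm (u - z)"
proof -
  let ?v = "pos_part u"
  have "0 \<le> (u $ i - ?v $ i) * (?v $ i - z $ i)" for i
    using assms(1) by (cases "0 \<le> u $ i") (auto simp: less_eq_vec_def max_def mult_le_0_iff)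
  then have "0 \<le> (u - ?v) \<bullet> (?v - z)"
    by (simp add: inner_vec_def sum_nonneg)
  moreover have "0 < (norm (?v - z))\<^sup>2"
    using assms(2) by simp
  moreover have "(norm (u - z))\<^sup>2 = (norm (u - ?v))\<^sup>2 + (norm (?v - z))\<^sup>2 + 2 * ((u - ?v) \<bullet> (?v - z))"
    by (simp add: power2_norm_eq_inner algebra_simps inner_commute)
  ultimately have "(norm (u - ?v))\<^sup>2 < (norm (u - z))\<^sup>2"
    by linarith
  then show ?thesis
    by (rule power2_less_imp_less) simp
qed

lemma argmin_norm_iff:
  "z \<in> argmin_set (\<lambda>z. (norm (u - z))\<^sup>2) S \<longleftrightarrow> z \<in> S \<and> (\<forall>w\<in>S. norm (u - z) \<le> norm (u - w))"
  by (auto simp: argmin_set_def is_arg_min_def not_less)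

text \<open>
  The scaled simplex is the part of the band where the sum is r, so z has fewer competitors there
  and stays a minimizer; the projection onto a scaled simplex is unique.
\<close>
lemma argmin_scaled_simplex_of_band:
  fixes u z :: "real ^ 'k::finite"
  assumes "0 \<le> p" "p \<le> r" "r \<le> q"
    and z: "z \<in> argmin_set (\<lambda>z. (norm (u - z))\<^sup>2) (sum_band p q)"
    and sum: "1 \<bullet> z = r"
  shows "argmin_set (\<lambda>z. (norm (u - z))\<^sup>2) (scaled_simplex r) = {z}"
proof -
  have "z \<in> argmin_set (\<lambda>z. (norm (u - z))\<^sup>2) (scaled_simplex r)"
    using assms by (auto simp: argmin_norm_iff sum_band_def scaled_simplex_def)
  then show ?thesis
    using argmin_set_scaled_simplex[of r u] assms(1,2) by auto
qed

text \<open>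
  The segment from z to the positive part v would otherwise pass through a point with sum r other
  than z. That point is feasible, and by convexity of the norm it is closer to u than z, because v
  is. Requiring the sum of v to differ from r makes v differ from z.
\<close>
lemma sum_argmin_between:
  fixes u z :: "real ^ 'k::finite"
  assumes r: "p \<le> r" "r \<le> q"
    and z: "z \<in> argmin_set (\<lambda>z. (norm (u - z))\<^sup>2) (sum_band p q)"
    and between: "1 \<bullet> pos_part u < r \<and> r \<le> 1 \<bullet> z \<or> 1 \<bullet> z \<le> r \<and> r < 1 \<bullet> pos_part u"
  shows "1 \<bullet> z = r"
proof (rule ccontr)
  assume ne: "1 \<bullet> z \<noteq> r"
  let ?v = "pos_part u"
  have z0: "0 \<le> z" and z_min: "\<And>w. w \<in> sum_band p q \<Longrightarrow> norm (u - z) \<le> norm (u - w)"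
    using z by (auto simp: argmin_norm_iff sum_band_def)
  have "z \<noteq> ?v"
    using between by auto
  (* The value of t at which the sum along the segment from z to v equals r. *)
  define t where "t = (1 \<bullet> z - r) / (1 \<bullet> z - 1 \<bullet> ?v)"
  define w where "w = (1 - t) *\<^sub>R z + t *\<^sub>R ?v"
  have t: "0 < t" "t \<le> 1"
    using between ne by (auto simp: t_def field_simps)
  have "t * (1 \<bullet> z - 1 \<bullet> ?v) = 1 \<bullet> z - r"
    using between by (auto simp: t_def)
  then have "1 \<bullet> w = r"
    by (simp add: w_def inner_add_right algebra_simps)
  moreover have "0 \<le> w"
    using t z0 pos_part_nonneg[of u] by (auto simp: w_def less_eq_vec_def)
  ultimately have "norm (u - z) \<le> norm (u - w)"
    using r by (intro z_min) (simp add: sum_band_def)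
  also have "u - w = (1 - t) *\<^sub>R (u - z) + t *\<^sub>R (u - ?v)"
    by (simp add: w_def algebra_simps)
  also have "norm \<dots> \<le> (1 - t) * norm (u - z) + t * norm (u - ?v)"
    using t by (intro norm_triangle_le) simp
  also have "\<dots> < (1 - t) * norm (u - z) + t * norm (u - z)"
    using pos_part_strictly_closest[OF z0 \<open>z \<noteq> ?v\<close>] t by simp
  finally show False
    by (simp add: algebra_simps)
qed

(* The coordinates are numbered 1, ..., k by e, so that u_j is u $ e j. *)
theorem lemma2:
  fixes u zstar :: "real ^ 'k::finite" and p q :: real
    and e :: "nat \<Rightarrow> 'k" and k m :: nat
  assumes k: "k = CARD('k)"
    and pq: "0 \<le> p" "p \<le> q" "q \<le> 1"
    and e: "bij_betw e {1..k} UNIV"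
    and m: "m = card {j \<in> {1..k}. 0 < u $ e j}"
    and ordered: "\<forall>j\<in>{1..m}. 0 < u $ e j"
    and zstar: "zstar \<in> argmin_set (\<lambda>z. (norm (u - z))\<^sup>2) (sum_band p q)"
  shows "((\<Sum>j=1..m. u $ e j) < p \<longrightarrow>
            argmin_set (\<lambda>z. (norm (u - z))\<^sup>2) (scaled_simplex p) = {zstar}) \<and>
         (p \<le> (\<Sum>j=1..m. u $ e j) \<and> (\<Sum>j=1..m. u $ e j) \<le> q \<longrightarrow>
            (\<forall>j\<in>{1..m}. zstar $ e j = u $ e j) \<and> (\<forall>j\<in>{m+1..k}. zstar $ e j = 0)) \<and>
         ((\<Sum>j=1..m. u $ e j) > q \<longrightarrow>
            argmin_set (\<lambda>z. (norm (u - z))\<^sup>2) (scaled_simplex q) = {zstar})"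
proof -
  let ?v = "pos_part u"
  let ?S = "\<Sum>j=1..m. u $ e j"
  (* The first m coordinates are positive and there are only m positive ones. *)
  have "m \<le> k"
    unfolding m by (rule order_trans[OF card_mono[of "{1..k}"]]) auto
  with ordered have "{1..m} \<subseteq> {j \<in> {1..k}. 0 < u $ e j}"
    by auto
  then have positive: "{1..m} = {j \<in> {1..k}. 0 < u $ e j}"
  proof (rule card_subset_eq[rotated])
    show "card {1..m} = card {j \<in> {1..k}. 0 < u $ e j}"
      by (subst m[symmetric]) simp
  qed simp
  have "1 \<bullet> ?v = (\<Sum>i\<in>UNIV. max (u $ i) 0)"
    by (simp add: inner_vec_def)
  also have "\<dots> = (\<Sum>j=1..k. max (u $ e j) 0)"
    by (rule sum.reindex_bij_betw[OF e, symmetric])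
  also have "\<dots> = (\<Sum>j=1..m. max (u $ e j) 0)"
    unfolding positive by (intro sum.mono_neutral_right) auto
  also have "\<dots> = ?S"
    using ordered by (intro sum.cong) simp_all
  finally have sum_v: "1 \<bullet> ?v = ?S" .
  have z0: "0 \<le> zstar" and z_sum: "p \<le> 1 \<bullet> zstar" "1 \<bullet> zstar \<le> q"
    and z_min: "\<And>w. w \<in> sum_band p q \<Longrightarrow> norm (u - zstar) \<le> norm (u - w)"
    using zstar by (auto simp: argmin_norm_iff sum_band_def)
  show ?thesis
  proof (intro conjI impI)
    assume "?S < p"
    then have "1 \<bullet> zstar = p"
      using sum_argmin_between[OF _ _ zstar, of p] pq z_sum sum_v by simp
    then show "argmin_set (\<lambda>z. (norm (u - z))\<^sup>2) (scaled_simplex p) = {zstar}"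
      using argmin_scaled_simplex_of_band[OF _ _ _ zstar] pq by simp
  next
    assume "q < ?S"
    then have "1 \<bullet> zstar = q"
      using sum_argmin_between[OF _ _ zstar, of q] pq z_sum sum_v by simp
    then show "argmin_set (\<lambda>z. (norm (u - z))\<^sup>2) (scaled_simplex q) = {zstar}"
      using argmin_scaled_simplex_of_band[OF _ _ _ zstar] pq by simp
  next
    assume "p \<le> ?S \<and> ?S \<le> q"
    then have "?v \<in> sum_band p q"
      using sum_v pos_part_nonneg[of u] by (simp add: sum_band_def)
    then have z_eq: "zstar = ?v"
      using z_min[of ?v] pos_part_strictly_closest[OF z0, of u] by (meson not_less)
    show "\<forall>j\<in>{1..m}. zstar $ e j = u $ e j"
      using ordered by (simp add: z_eq)
    show "\<forall>j\<in>{m+1..k}. zstar $ e j = 0"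
    proof
      fix j assume j: "j \<in> {m+1..k}"
      then have "j \<notin> {1..m}" "j \<in> {1..k}"
        by auto
      then have "u $ e j \<le> 0"
        unfolding positive by auto
      then show "zstar $ e j = 0"
        by (simp add: z_eq)
    qed
  qed
qed

end
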